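(* Let $G$ be a finite simple graph (with at least one edge). Then $B(G)$ is standard graded if and only if $A(G)$ is standard graded.
   Context: Let $K$ be a field, let $G$ be a graph on the vertex set $[n]=\{1,\ldots,n\}$, and let $S=K[x_1,\ldots,x_n]$. For $k\ge 0$, a $k$-cover of $G$ is a nonzero vector $c\in\mathbb{Z}_{\ge 0}^n$ with $c_i+c_j\ge k$ for every edge $\{i,j\}$ of $G$ (isolated vertices impose no condition); it is squarefree if all $c_i\le 1$. Write $x^c=x_1^{c_1}\cdots x_n^{c_n}$. For $k\ge 1$, $J_k(G)\subseteq S$ is the ideal spanned over $K$ by the monomials $x^c$ with $c$ a $k$-cover, $J_0(G)=S$, and $A(G)=\bigoplus_{k\ge 0}J_k(G)t^k\subseteq S[t]$. $B(G)\subseteq S[t]$ is the $S$-subalgebra generated by all $x^ct^k$ with $k\ge 1$ and $c$ a squarefree $k$-cover of $G$. Both algebras are graded by the degree in $t$ (so $S$ is in degree $0$); such an algebra is standard graded if it is generated as an $S$-algebra by its elements of degree $1$. *)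

theory Defs
  imports "HOL-Library.Poly_Mapping" "HOL-Computational_Algebra.Polynomial" "HOL.Hull"
begin

text \<open>
  The vertex set is a finite type \<open>'v\<close>, in place of \<open>[n]\<close> with \<open>n = CARD('v)\<close>.
  A vector in \<open>\<int>\<^sub>\<ge>\<^sub>0\<^sup>n\<close> is an element of \<open>'v \<Rightarrow>\<^sub>0 nat\<close>, so that
  \<open>('v \<Rightarrow>\<^sub>0 nat) \<Rightarrow>\<^sub>0 'k\<close>, with the convolution product of \<open>Poly_Mapping\<close>, is
  \<open>S = K[x\<^sub>1,\<dots>,x\<^sub>n]\<close>, and \<open>('v, 'k) mpoly poly\<close> is \<open>S[t]\<close>.
\<close>

type_synonym ('v, 'k) mpoly = "('v \<Rightarrow>\<^sub>0 nat) \<Rightarrow>\<^sub>0 'k"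

definition x_power :: "('v \<Rightarrow>\<^sub>0 nat) \<Rightarrow> ('v, 'k::field) mpoly" where
  "x_power c = Poly_Mapping.single c 1"

definition scalar :: "'k::field \<Rightarrow> ('v, 'k) mpoly \<Rightarrow> ('v, 'k) mpoly" where
  "scalar a p = Poly_Mapping.single 0 a * p"

lemma vector_space_scalar: "vector_space scalar"
  by unfold_locales
    (simp_all add: scalar_def algebra_simps single_add mult_single flip: mult.assoc)

text \<open>A graph on \<open>'v\<close> is given by its set of edges.\<close>

definition simple_graph :: "'v set set \<Rightarrow> bool" where
  "simple_graph E \<longleftrightarrow> (\<forall>e\<in>E. card e = 2)"

definition k_cover :: "'v set set \<Rightarrow> nat \<Rightarrow> ('v \<Rightarrow>\<^sub>0 nat) \<Rightarrow> bool" where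
  "k_cover E k c \<longleftrightarrow> c \<noteq> 0 \<and>
     (\<forall>i j. {i, j} \<in> E \<longrightarrow> Poly_Mapping.lookup c i + Poly_Mapping.lookup c j \<ge> k)"

definition squarefree_vec :: "('v \<Rightarrow>\<^sub>0 nat) \<Rightarrow> bool" where
  "squarefree_vec c \<longleftrightarrow> (\<forall>i. Poly_Mapping.lookup c i \<le> 1)"

definition cover_ideal :: "'v set set \<Rightarrow> nat \<Rightarrow> ('v, 'k::field) mpoly set" where
  "cover_ideal E k =
     (if k = 0 then UNIV else module.span scalar {x_power c | c. k_cover E k c})"

text \<open>\<open>\<Oplus>\<^sub>k J\<^sub>k(G) t\<^sup>k\<close>: the polynomials in \<open>t\<close> whose coefficient of \<open>t\<^sup>k\<close> lies in \<open>J\<^sub>k(G)\<close>.\<close>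

definition algebra_A :: "'v set set \<Rightarrow> ('v, 'k::field) mpoly poly set" where
  "algebra_A E = {p. \<forall>k. coeff p k \<in> cover_ideal E k}"

text \<open>
  Subalgebras of \<open>R[t]\<close> over the coefficient ring \<open>R\<close>. Closure under negation and under
  multiplication by scalars follows from containing the constants.
\<close>

definition subalgebra :: "'r::comm_ring_1 poly set \<Rightarrow> bool" where
  "subalgebra T \<longleftrightarrow>
     (\<forall>s. [:s:] \<in> T) \<and> (\<forall>p\<in>T. \<forall>q\<in>T. p + q \<in> T) \<and> (\<forall>p\<in>T. \<forall>q\<in>T. p * q \<in> T)"

definition algebra_B :: "'v set set \<Rightarrow> ('v, 'k::field) mpoly poly set" where
  "algebra_B E =
     subalgebra hull {monom (x_power c) k | c k. k \<ge> 1 \<and> k_cover E k c \<and> squarefree_vec c}"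

text \<open>The elements of degree 1 of \<open>T\<close> are those of the form \<open>s t\<close> with \<open>s\<close> in the coefficient ring.\<close>

definition standard_graded :: "'r::comm_ring_1 poly set \<Rightarrow> bool" where
  "standard_graded T \<longleftrightarrow> T = subalgebra hull {p \<in> T. \<exists>s. p = monom s 1}"

end

theory Submission
  imports Defs
begin

text \<open>
  Both conditions are equivalent to \<open>G\<close> being bipartite.

  If \<open>B(G)\<close> or \<open>A(G)\<close> is standard graded, then the element \<open>x\<^sub>1\<cdots>x\<^sub>n t\<^sup>2\<close>, which lies in both algebras,
  is a combination of products of two elements of degree 1 of \<open>A(G)\<close>.  Comparing monomials,
  \<open>(1,\<dots>,1) \<ge> a + b\<close> for two 1-covers \<open>a\<close> and \<open>b\<close>: these are the indicators of two disjoint vertex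
  covers.  On an edge each of them takes exactly one end, so that \<open>a\<close> is a proper 2-colouring
  (\<open>bipartite_if_standard_graded\<close>).

  If \<open>G\<close> is bipartite, every \<open>(k+1)\<close>-cover is the sum of a squarefree 1-cover and a \<open>k\<close>-cover
  (\<open>bipartite_split_cover\<close>).  By induction \<open>A(G)\<close> is generated by the \<open>x\<^sup>a t\<close> with \<open>a\<close> a squarefree
  1-cover; since these generators belong to \<open>B(G) \<subseteq> A(G)\<close>, the two algebras coincide and are
  standard graded (\<open>bipartite_imp_algebra_B_eq_algebra_A\<close>,
  \<open>bipartite_imp_standard_graded\<close>).
\<close>

section \<open>Subalgebras\<close>

lemma subalgebra_hull: "subalgebra (subalgebra hull X)"
  by (rule hull_in) (auto simp: subalgebra_def)

lemma subalgebra_sum: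
  assumes "subalgebra T" "\<And>i. i \<in> I \<Longrightarrow> f i \<in> T"
  shows "sum f I \<in> T"
proof (cases "finite I")
  case True
  then show ?thesis
    using assms(2)
  proof (induction I rule: finite_induct)
    case empty
    have "[:0:] \<in> T"
      using assms(1) unfolding subalgebra_def by blast
    then show ?case
      by simp
  next
    case (insert i I)
    then show ?case
      using assms(1) by (simp add: subalgebra_def)
  qed
next
  case False
  have "[:0:] \<in> T"
    using assms(1) unfolding subalgebra_def by blast
  then show ?thesis
    using False by simp
qed

lemma standard_gradedI:
  assumes "subalgebra T" "T \<subseteq> subalgebra hull X"
    and "\<And>p. p \<in> X \<Longrightarrow> p \<in> T \<and> (\<exists>s. p = monom s 1)"
  shows "standard_graded T"
  unfolding standard_graded_def
proof
  have "subalgebra hull X \<subseteq> subalgebra hull {p \<in> T. \<exists>s. p = monom s 1}"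
    by (rule hull_mono) (use assms(3) in blast)
  then show "T \<subseteq> subalgebra hull {p \<in> T. \<exists>s. p = monom s 1}"
    using assms(2) by blast
  show "subalgebra hull {p \<in> T. \<exists>s. p = monom s 1} \<subseteq> T"
    by (rule hull_minimal) (use assms(1) in auto)
qed

section \<open>Covers and the algebra of covers\<close>

text \<open>
  The inequalities in the definition of a \<open>k\<close>-cover.  They are void for \<open>k = 0\<close>, and force a
  nonzero vector when \<open>k \<ge> 1\<close> and there is an edge; so degree 0 needs no separate treatment.
\<close>

definition covers :: "'v set set \<Rightarrow> nat \<Rightarrow> ('v \<Rightarrow>\<^sub>0 nat) \<Rightarrow> bool" where
  "covers E k c \<longleftrightarrow> (\<forall>i j. {i, j} \<in> E \<longrightarrow> k \<le> Poly_Mapping.lookup c i + Poly_Mapping.lookup c j)"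

lemma covers_0 [simp]: "covers E 0 c"
  by (simp add: covers_def)

lemma covers_add:
  assumes "covers E k a" "covers E l b"
  shows "covers E (k + l) (a + b)"
  unfolding covers_def
proof (intro allI impI)
  fix i j
  assume "{i, j} \<in> E"
  then have "k \<le> Poly_Mapping.lookup a i + Poly_Mapping.lookup a j"
    and "l \<le> Poly_Mapping.lookup b i + Poly_Mapping.lookup b j"
    using assms unfolding covers_def by blast+
  then show "k + l \<le> Poly_Mapping.lookup (a + b) i + Poly_Mapping.lookup (a + b) j"
    by (simp add: lookup_add)
qed

lemma k_cover_eq_covers:
  assumes "simple_graph E" "E \<noteq> {}" "k \<ge> 1"
  shows "k_cover E k c \<longleftrightarrow> covers E k c"
proof -
  obtain e where e: "e \<in> E"
    using assms(2) by blast
  then have "card e = 2"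
    using assms(1) by (simp add: simple_graph_def)
  then obtain i j where "e = {i, j}"
    by (auto simp: card_2_iff)
  then have "\<not> covers E k 0"
    using e assms(3) unfolding covers_def by force
  then show ?thesis
    unfolding k_cover_def covers_def by auto
qed

lemma poly_mapping_sum_monomials:
  "(\<Sum>c\<in>Poly_Mapping.keys p. Poly_Mapping.single c (Poly_Mapping.lookup p c)) = p"
  by (rule poly_mapping_eqI)
    (auto simp: lookup_sum lookup_single when_def sum.delta in_keys_iff)

lemma sum_scalar_x_power:
  "(\<Sum>c\<in>Poly_Mapping.keys p. scalar (Poly_Mapping.lookup p c) (x_power c)) = p"
  by (simp add: scalar_def x_power_def mult_single poly_mapping_sum_monomials)

text \<open>Since \<open>J\<^sub>k(G)\<close> is spanned by monomials, membership can be tested on the support.\<close>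

lemma mem_cover_ideal_iff:
  assumes "simple_graph E" "E \<noteq> {}"
  shows "(p :: ('v, 'k::field) mpoly) \<in> cover_ideal E k \<longleftrightarrow> (\<forall>c\<in>Poly_Mapping.keys p. covers E k c)"
proof (cases "k = 0")
  case True
  then show ?thesis
    by (simp add: cover_ideal_def)
next
  case False
  interpret vector_space "scalar :: 'k \<Rightarrow> ('v, 'k) mpoly \<Rightarrow> ('v, 'k) mpoly"
    by (rule vector_space_scalar)
  let ?X = "{x_power c :: ('v, 'k) mpoly | c. covers E k c}"
  have ideal: "cover_ideal E k = span ?X"
    using False k_cover_eq_covers[OF assms] by (simp add: cover_ideal_def)
  have "\<forall>c\<in>Poly_Mapping.keys p. covers E k c" if "p \<in> span ?X"
    using that
  proof (induction rule: span_induct_alt)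
    case base
    show ?case
      by simp
  next
    case (step a x q)
    then obtain c where x: "x = x_power c" and c: "covers E k c"
      by blast
    have "Poly_Mapping.keys (scalar a x + q) \<subseteq> insert c (Poly_Mapping.keys q)"
      using Poly_Mapping.keys_add[of "scalar a x" q]
      by (auto simp: x scalar_def x_power_def mult_single split: if_splits)
    then show ?case
      using step.IH c by blast
  qed
  moreover have "p \<in> span ?X" if "\<forall>c\<in>Poly_Mapping.keys p. covers E k c"
  proof -
    have "(\<Sum>c\<in>Poly_Mapping.keys p. scalar (Poly_Mapping.lookup p c) (x_power c)) \<in> span ?X"
      by (intro span_sum span_scale span_base) (use that in blast)
    then show ?thesis
      by (simp only: sum_scalar_x_power)
  qed
  ultimately show ?thesis
    using ideal by blast
qed

lemma mem_algebra_A_iff: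
  assumes "simple_graph E" "E \<noteq> {}"
  shows "p \<in> algebra_A E \<longleftrightarrow> (\<forall>k. \<forall>c\<in>Poly_Mapping.keys (coeff p k). covers E k c)"
  by (simp add: algebra_A_def mem_cover_ideal_iff[OF assms])

lemma monom_x_power_in_algebra_A:
  assumes "simple_graph E" "E \<noteq> {}" "covers E k c"
  shows "monom (x_power c) k \<in> algebra_A E"
  using assms(3) by (auto simp: mem_algebra_A_iff[OF assms(1,2)] x_power_def split: if_splits)

lemma keys_coeff_multD:
  fixes p q :: "('v, 'k::field) mpoly poly"
  assumes "c \<in> Poly_Mapping.keys (coeff (p * q) n)"
  obtains i a b where "i \<le> n" "c = a + b"
    "a \<in> Poly_Mapping.keys (coeff p i)" "b \<in> Poly_Mapping.keys (coeff q (n - i))"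
proof -
  have "c \<in> (\<Union>i\<le>n. Poly_Mapping.keys (coeff p i * coeff q (n - i)))"
    using assms Poly_Mapping.keys_sum[of "\<lambda>i. coeff p i * coeff q (n - i)" "{..n}"]
    by (auto simp: coeff_mult)
  then show thesis
    using keys_mult that by fast
qed

lemma subalgebra_algebra_A:
  assumes "simple_graph E" "E \<noteq> {}"
  shows "subalgebra (algebra_A E :: ('v, 'k::field) mpoly poly set)"
  unfolding subalgebra_def
proof (intro conjI allI ballI)
  fix s :: "('v, 'k) mpoly"
  show "[:s:] \<in> algebra_A E"
    by (auto simp: mem_algebra_A_iff[OF assms] coeff_pCons split: nat.splits)
next
  fix p q :: "('v, 'k) mpoly poly"
  assume p: "p \<in> algebra_A E" and q: "q \<in> algebra_A E"
  show "p + q \<in> algebra_A E"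
    using p q Poly_Mapping.keys_add by (fastforce simp: mem_algebra_A_iff[OF assms])
  have "covers E k c" if c: "c \<in> Poly_Mapping.keys (coeff (p * q) k)" for k c
  proof -
    obtain i a b where i: "i \<le> k" and c: "c = a + b"
      and "a \<in> Poly_Mapping.keys (coeff p i)" "b \<in> Poly_Mapping.keys (coeff q (k - i))"
      using keys_coeff_multD[OF c] by metis
    then have "covers E (i + (k - i)) (a + b)"
      using p q by (intro covers_add) (simp_all add: mem_algebra_A_iff[OF assms])
    then show ?thesis
      using i c by simp
  qed
  then show "p * q \<in> algebra_A E"
    by (simp add: mem_algebra_A_iff[OF assms])
qed

lemma algebra_B_subset_algebra_A:
  assumes "simple_graph E" "E \<noteq> {}"
  shows "algebra_B E \<subseteq> (algebra_A E :: ('v, 'k::field) mpoly poly set)"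
  unfolding algebra_B_def
  by (rule hull_minimal)
    (auto simp: k_cover_eq_covers[OF assms] intro: monom_x_power_in_algebra_A[OF assms]
      subalgebra_algebra_A[OF assms])

section \<open>Standard grading and bipartiteness\<close>

definition bipartite :: "'v set set \<Rightarrow> bool" where
  "bipartite E \<longleftrightarrow> (\<exists>U. \<forall>i j. {i, j} \<in> E \<longrightarrow> (i \<in> U) \<noteq> (j \<in> U))"

text \<open>
  The product of \<open>p\<close> and \<open>q\<close> has \<open>p\<^sub>0 q\<^sub>2 + p\<^sub>1 q\<^sub>1 + p\<^sub>2 q\<^sub>0\<close> in degree 2.  The claim passes from
  \<open>p\<^sub>2\<close> and \<open>q\<^sub>2\<close> to the outer terms, and holds for the middle one if \<open>p\<^sub>1\<close> and \<open>q\<^sub>1\<close> are supported on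
  1-covers; the two conditions together thus define a subalgebra.
\<close>

lemma degree_2_of_hull_degree_1:
  fixes E :: "'v set set"
  assumes "simple_graph E" "E \<noteq> {}"
    and "p \<in> subalgebra hull {p \<in> (algebra_A E :: ('v, 'k::field) mpoly poly set). \<exists>s. p = monom s 1}"
    and "c \<in> Poly_Mapping.keys (coeff p 2)"
  obtains a b d where "c = a + b + d" "covers E 1 a" "covers E 1 b"
proof -
  define T :: "('v, 'k) mpoly poly set" where
    "T = {p. (\<forall>c\<in>Poly_Mapping.keys (coeff p 1). covers E 1 c) \<and>
      (\<forall>c\<in>Poly_Mapping.keys (coeff p 2). \<exists>a b d. c = a + b + d \<and> covers E 1 a \<and> covers E 1 b)}"
  have "subalgebra T"
    unfolding subalgebra_def
  proof (intro conjI allI ballI)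
    fix s :: "('v, 'k) mpoly"
    show "[:s:] \<in> T"
      by (simp add: T_def coeff_pCons numeral_2_eq_2)
  next
    fix p q :: "('v, 'k) mpoly poly"
    assume p: "p \<in> T" and q: "q \<in> T"
    show "p + q \<in> T"
      using p q Poly_Mapping.keys_add[of "coeff p 1" "coeff q 1"]
        Poly_Mapping.keys_add[of "coeff p 2" "coeff q 2"]
      unfolding T_def coeff_add mem_Collect_eq by blast
    have "covers E 1 c" if c: "c \<in> Poly_Mapping.keys (coeff (p * q) 1)" for c
    proof -
      obtain i a b where i: "i \<le> 1" and c: "c = a + b" and a: "a \<in> Poly_Mapping.keys (coeff p i)"
        and b: "b \<in> Poly_Mapping.keys (coeff q (1 - i))"
        using keys_coeff_multD[OF c] by metis
      have "covers E i a" "covers E (1 - i) b"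
        using i a b p q by (auto simp: T_def le_Suc_eq)
      from covers_add[OF this] show ?thesis
        using i c by simp
    qed
    moreover have "\<exists>a b d. c = a + b + d \<and> covers E 1 a \<and> covers E 1 b"
      if c: "c \<in> Poly_Mapping.keys (coeff (p * q) 2)" for c
    proof -
      obtain i x y where i: "i \<le> 2" and c: "c = x + y" and x: "x \<in> Poly_Mapping.keys (coeff p i)"
        and y: "y \<in> Poly_Mapping.keys (coeff q (2 - i))"
        using keys_coeff_multD[OF c] by metis
      consider "i = 0" | "i = 1" | "i = 2"
        using i by linarith
      then show ?thesis
      proof cases
        case 1
        then obtain a b d where "y = a + b + d" "covers E 1 a" "covers E 1 b"
          using y q unfolding T_def by auto
        then have "c = a + b + (d + x)" "covers E 1 a" "covers E 1 b"
          by (simp_all add: c ac_simps)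
        then show ?thesis
          by blast
      next
        case 2
        then have "covers E 1 x" "covers E 1 y"
          using x y p q unfolding T_def by auto
        moreover have "c = x + y + 0"
          by (simp add: c)
        ultimately show ?thesis
          by blast
      next
        case 3
        then obtain a b d where "x = a + b + d" "covers E 1 a" "covers E 1 b"
          using x p unfolding T_def by auto
        then have "c = a + b + (d + y)" "covers E 1 a" "covers E 1 b"
          by (simp_all add: c ac_simps)
        then show ?thesis
          by blast
      qed
    qed
    ultimately show "p * q \<in> T"
      by (simp add: T_def)
  qed
  moreover have "{p \<in> algebra_A E. \<exists>s. p = monom s 1} \<subseteq> T"
    by (auto simp: T_def mem_algebra_A_iff[OF assms(1,2)])
  ultimately have "p \<in> T"
    using assms(3) hull_minimal[of _ T subalgebra] by blast
  then show thesis
    using assms(4) that unfolding T_def by blast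
qed

lift_definition ones :: "'v::finite \<Rightarrow>\<^sub>0 nat" is "\<lambda>_. 1"
  by simp

lemma monom_ones_in_algebra_B:
  assumes "simple_graph E" "E \<noteq> {}"
  shows "monom (x_power ones) 2 \<in> (algebra_B E :: ('v::finite, 'k::field) mpoly poly set)"
proof -
  have "k_cover E 2 ones"
    by (subst k_cover_eq_covers[OF assms]) (simp_all add: covers_def ones.rep_eq)
  moreover have "squarefree_vec (ones :: 'v \<Rightarrow>\<^sub>0 nat)"
    by (simp add: squarefree_vec_def ones.rep_eq)
  ultimately show ?thesis
    unfolding algebra_B_def by (intro hull_inc) force
qed

text \<open>
  Writing \<open>(1,\<dots>,1) = a + b + d\<close>, at each vertex at most one of \<open>a\<close> and \<open>b\<close> is nonzero.  If \<open>a\<close> were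
  positive at both ends of an edge, \<open>b\<close> would vanish there and not cover it; and \<open>a\<close> is positive at
  one end at least.  Hence the support of \<open>a\<close> is one side of a bipartition.
\<close>

lemma bipartite_if_standard_graded:
  fixes T :: "('v::finite, 'k::field) mpoly poly set"
  assumes "simple_graph E" "E \<noteq> {}"
    and "standard_graded T" "algebra_B E \<subseteq> T" "T \<subseteq> algebra_A E"
  shows "bipartite E"
proof -
  have "T \<subseteq> subalgebra hull {p \<in> algebra_A E. \<exists>s. p = monom s 1}"
    using assms(3,5) hull_mono[of "{p \<in> T. \<exists>s. p = monom s 1}" "{p \<in> algebra_A E. \<exists>s. p = monom s 1}"]
    unfolding standard_graded_def by blast
  then have "(monom (x_power ones) 2 :: ('v, 'k) mpoly poly)
      \<in> subalgebra hull {p \<in> algebra_A E. \<exists>s. p = monom s 1}"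
    using monom_ones_in_algebra_B[OF assms(1,2)] assms(4) by blast
  moreover have "ones \<in> Poly_Mapping.keys (coeff (monom (x_power ones) 2 :: ('v, 'k) mpoly poly) 2)"
    by (simp add: x_power_def)
  ultimately obtain a b d where ones: "(ones :: 'v \<Rightarrow>\<^sub>0 nat) = a + b + d"
    and a: "covers E 1 a" and b: "covers E 1 b"
    by (rule degree_2_of_hull_degree_1[OF assms(1,2)])
  have le: "Poly_Mapping.lookup a i + Poly_Mapping.lookup b i \<le> 1" for i
  proof -
    have "1 = Poly_Mapping.lookup (a + b + d) i"
      by (simp add: ones.rep_eq flip: ones)
    then show ?thesis
      by (simp add: lookup_add)
  qed
  have "(0 < Poly_Mapping.lookup a i) \<noteq> (0 < Poly_Mapping.lookup a j)" if "{i, j} \<in> E" for i j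
  proof -
    have "1 \<le> Poly_Mapping.lookup a i + Poly_Mapping.lookup a j"
      and "1 \<le> Poly_Mapping.lookup b i + Poly_Mapping.lookup b j"
      using a b that unfolding covers_def by blast+
    then show ?thesis
      using le[of i] le[of j] by linarith
  qed
  then show ?thesis
    unfolding bipartite_def by (intro exI[of _ "{i. 0 < Poly_Mapping.lookup a i}"]) simp
qed

text \<open>
  Let \<open>U\<close> be one side.  The 1-cover takes the vertices of \<open>U\<close> where \<open>c\<close> is positive, and on the
  other side only those where \<open>c\<close> is at least \<open>k + 1\<close>, which is forced for the neighbours of a zero of
  \<open>c\<close> in \<open>U\<close>.  An edge then loses 2 only if its value was at least \<open>k + 2\<close>.
\<close>

lemma bipartite_split_cover:
  fixes c :: "'v::finite \<Rightarrow>\<^sub>0 nat"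
  assumes "bipartite E" "covers E (Suc k) c"
  obtains a b where "c = a + b" "squarefree_vec a" "covers E 1 a" "covers E k b"
proof -
  obtain U where U: "\<And>i j. {i, j} \<in> E \<Longrightarrow> (i \<in> U) \<noteq> (j \<in> U)"
    using assms(1) unfolding bipartite_def by blast
  let ?c = "Poly_Mapping.lookup c"
  define f :: "'v \<Rightarrow> nat" where "f i = (if (if i \<in> U then 0 else k) < ?c i then 1 else 0)" for i
  have f_le: "f i \<le> ?c i" for i
    by (auto simp: f_def)
  define a where "a = Abs_poly_mapping f"
  have a: "Poly_Mapping.lookup a = f"
    by (simp add: a_def)
  define b where "b = c - a"
  have b: "Poly_Mapping.lookup b i = ?c i - f i" for i
    by (simp add: b_def a lookup_minus)
  have edge: "1 \<le> f i + f j \<and> k \<le> (?c i - f i) + (?c j - f j)" if "{i, j} \<in> E" for i j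
  proof -
    have "Suc k \<le> ?c i + ?c j"
      using assms(2) that unfolding covers_def by blast
    then show ?thesis
      using U[OF that] by (auto simp: f_def)
  qed
  show thesis
  proof
    show "c = a + b"
      by (rule poly_mapping_eqI) (simp add: lookup_add a b f_le)
    show "squarefree_vec a"
      by (simp add: squarefree_vec_def a f_def)
    show "covers E 1 a" "covers E k b"
      using edge by (simp_all add: covers_def a b)
  qed
qed

lemma monomial_in_hull_squarefree_1_covers:
  fixes E :: "'v::finite set set" and r :: "'k::field"
  assumes "bipartite E" "covers E k c"
  shows "monom (Poly_Mapping.single c r) k
    \<in> subalgebra hull {monom (x_power a) 1 | a. covers E 1 a \<and> squarefree_vec a}"
    (is "_ \<in> subalgebra hull ?X")
  using assms(2)
proof (induction k arbitrary: c)
  case 0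
  show ?case
    using subalgebra_hull[of ?X] unfolding subalgebra_def[of "subalgebra hull ?X"] monom_0 by blast
next
  case (Suc k)
  obtain a b where c: "c = a + b" and a: "squarefree_vec a" "covers E 1 a" and b: "covers E k b"
    by (rule bipartite_split_cover[OF assms(1) Suc.prems])
  have "monom (x_power a) 1 * monom (Poly_Mapping.single b r) k \<in> subalgebra hull ?X"
    using subalgebra_hull[of ?X] Suc.IH[OF b] hull_inc[of "monom (x_power a) 1" ?X subalgebra] a
    unfolding subalgebra_def[of "subalgebra hull ?X"] by blast
  then show ?case
    by (simp add: c mult_monom x_power_def mult_single)
qed

lemma bipartite_algebra_A_subset_hull:
  fixes E :: "'v::finite set set"
  assumes "simple_graph E" "E \<noteq> {}" "bipartite E"
  shows "(algebra_A E :: ('v, 'k::field) mpoly poly set)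
    \<subseteq> subalgebra hull {monom (x_power a) 1 | a. covers E 1 a \<and> squarefree_vec a}"
    (is "_ \<subseteq> ?H")
proof
  fix p :: "('v, 'k) mpoly poly"
  assume p: "p \<in> algebra_A E"
  have "monom (coeff p k) k \<in> ?H" for k
  proof -
    let ?q = "coeff p k"
    have "monom ?q k =
        monom (\<Sum>c\<in>Poly_Mapping.keys ?q. Poly_Mapping.single c (Poly_Mapping.lookup ?q c)) k"
      by (simp only: poly_mapping_sum_monomials)
    also have "\<dots> =
        (\<Sum>c\<in>Poly_Mapping.keys ?q. monom (Poly_Mapping.single c (Poly_Mapping.lookup ?q c)) k)"
      by (rule monom_sum)
    also have "\<dots> \<in> ?H"
      using p by (intro subalgebra_sum subalgebra_hull
          monomial_in_hull_squarefree_1_covers[OF assms(3)])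
        (simp add: mem_algebra_A_iff[OF assms(1,2)])
    finally show ?thesis .
  qed
  then have "(\<Sum>k\<le>degree p. monom (coeff p k) k) \<in> ?H"
    by (intro subalgebra_sum subalgebra_hull)
  then show "p \<in> ?H"
    by (simp only: poly_as_sum_of_monoms)
qed

lemma
  fixes E :: "'v::finite set set"
  assumes "simple_graph E" "E \<noteq> {}" "bipartite E"
  shows bipartite_imp_algebra_B_eq_algebra_A:
      "algebra_B E = (algebra_A E :: ('v, 'k::field) mpoly poly set)"
    and bipartite_imp_standard_graded: "standard_graded (algebra_A E :: ('v, 'k) mpoly poly set)"
proof -
  let ?X = "{monom (x_power a) 1 :: ('v, 'k) mpoly poly | a. covers E 1 a \<and> squarefree_vec a}"
  have A_sub: "algebra_A E \<subseteq> subalgebra hull ?X"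
    by (rule bipartite_algebra_A_subset_hull[OF assms])
  have "?X \<subseteq> {monom (x_power c) k | c k. k \<ge> 1 \<and> k_cover E k c \<and> squarefree_vec c}"
    using k_cover_eq_covers[OF assms(1,2), of 1] by blast
  then have "subalgebra hull ?X \<subseteq> algebra_B E"
    unfolding algebra_B_def by (rule hull_mono)
  with A_sub show "algebra_B E = (algebra_A E :: ('v, 'k) mpoly poly set)"
    using algebra_B_subset_algebra_A[OF assms(1,2)] by blast
  show "standard_graded (algebra_A E :: ('v, 'k) mpoly poly set)"
    using subalgebra_algebra_A[OF assms(1,2)] A_sub
    by (rule standard_gradedI) (auto intro: monom_x_power_in_algebra_A[OF assms(1,2)])
qed

theorem proposition2p2:
  fixes E :: "'v::finite set set"
  assumes "simple_graph E"
    and "E \<noteq> {}"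
  shows "standard_graded (algebra_B E :: ('v, 'k::field) mpoly poly set)
     \<longleftrightarrow> standard_graded (algebra_A E :: ('v, 'k) mpoly poly set)"
proof
  assume "standard_graded (algebra_B E :: ('v, 'k) mpoly poly set)"
  then have "bipartite E"
    using bipartite_if_standard_graded[OF assms] algebra_B_subset_algebra_A[OF assms] by blast
  then show "standard_graded (algebra_A E :: ('v, 'k) mpoly poly set)"
    by (rule bipartite_imp_standard_graded[OF assms])
next
  assume A: "standard_graded (algebra_A E :: ('v, 'k) mpoly poly set)"
  then have "bipartite E"
    using bipartite_if_standard_graded[OF assms] algebra_B_subset_algebra_A[OF assms] by blast
  then have "algebra_B E = (algebra_A E :: ('v, 'k) mpoly poly set)"
    by (rule bipartite_imp_algebra_B_eq_algebra_A[OF assms])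
  then show "standard_graded (algebra_B E :: ('v, 'k) mpoly poly set)"
    using A by simp
qed

end
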